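(* Let $d\ge 2$, let $L=(G,p)$ be a connected linkage in $\mathbb{R}^d$ with infinitesimally independent edge constraints and with $d$ marked pairs of vertices $\{v_{i(k)},v_{j(k)}\}$, $k=1,\dots,d$, such that the vectors $\lambda_k=p(v_{j(k)})-p(v_{i(k)})$ form a basis of $\mathbb{R}^d$, and let $\tilde L$ be the associated periodic framework. Then $\tilde L$ has a non-trivial auxetic deformation path if and only if $L$ has a local one-parameter deformation $p_\tau$, $\tau\in(-\epsilon,\epsilon)$, with the following property: the Gram matrix $\omega(\tau)=(\langle\lambda_a(\tau),\lambda_b(\tau)\rangle)_{1\le a,b\le d}$ of the basis $\lambda_k(\tau)=p_\tau(v_{j(k)})-p_\tau(v_{i(k)})$ given by the $d$ marked pairs of vertices evolves (in the space of symmetric $d\times d$ matrices) as a non-constant curve with all its tangents $\frac{d\omega}{d\tau}(\tau)$ in the cone of positive semidefinite matrices.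
   Context: Linkages. A linkage in $\mathbb{R}^d$ is a pair $L=(G,p)$ where $G=(V,E)$ is a finite simple connected graph and $p:V\to\mathbb{R}^d$ is a placement with $p(u)\ne p(v)$ for every edge $(u,v)\in E$. The edge constraints are infinitesimally independent if the rows of the rigidity matrix (the linear functionals $(\dot p_v)_{v\in V}\mapsto\langle p(u)-p(v),\dot p_u-\dot p_v\rangle$, $(u,v)\in E$) are linearly independent. A local one-parameter deformation of $L$ is a smooth family of placements $p_\tau:V\to\mathbb{R}^d$, $\tau\in(-\epsilon,\epsilon)$, with $p_0=p$, preserving the lengths of all edges. Periodic frameworks. A $d$-periodic graph $(\tilde G,\Gamma)$ is a simple infinite graph $\tilde G=(\tilde V,\tilde E)$ with finite vertex degrees together with a free Abelian group $\Gamma\subset\mathrm{Aut}(\tilde G)$ of rank $d$ acting without fixed points on vertices and edges, with finitely many vertex and edge orbits. A $d$-periodic framework $(\tilde G,\Gamma,\tilde p,\pi)$ consists in addition of $\tilde p:\tilde V\to\mathbb{R}^d$ and an injective homomorphism $\pi$ from $\Gamma$ to the translations of $\mathbb{R}^d$ with $\pi(\Gamma)$ a lattice of rank $d$, such that $\tilde p(\gamma v)=\pi(\gamma)(\tilde p(v))$, and endpoints of edges have distinct images. A deformation path is a smooth family of periodic placements $(\tilde p_\tau,\pi_\tau)$, $\tau\in(-\epsilon,\epsilon)$, of $(\tilde G,\Gamma)$ with $(\tilde p_0,\pi_0)=(\tilde p,\pi)$, preserving all edge lengths ($\pi_\tau$ may vary with $\tau$). Fix independent generators of $\Gamma$ and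 let $\Lambda_\tau$ be the $d\times d$ matrix whose columns are the translation vectors of their images under $\pi_\tau$; the Gram matrix is $\omega(\tau)=\Lambda_\tau^t\Lambda_\tau$. The path is auxetic if $\frac{d\omega}{d\tau}(\tau)$ is positive semidefinite for all $\tau\in(-\epsilon,\epsilon)$. An auxetic path is non-trivial if its curve of Gram matrices is non-constant. Associated periodic framework $\tilde L$. Let $\Lambda$ be the lattice generated by $\lambda_1,\dots,\lambda_d$ and $\Gamma=\Lambda$. The vertex set $\tilde V$ of $\tilde G$ is the quotient of the set of formal symbols $v+\lambda$ ($v\in V$, $\lambda\in\Lambda$) by the $\Lambda$-invariant equivalence relation generated by $v_{j(k)}+\lambda\sim v_{i(k)}+\lambda_k+\lambda$, $k=1,\dots,d$. The edges $\tilde E$ are all formal $\Lambda$-translates of the edges in $E$ (with $V$ included in $\tilde V$ via $v\mapsto v+0$), the placement is $\tilde p(v+\lambda)=p(v)+\lambda$, and $\pi$ is the identification of $\Gamma=\Lambda$ with the group of translations by elements of $\Lambda$. *)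

theory Defs
  imports
    "HOL-Analysis.Analysis"
    "HOL-Algebra.Group_Action"
    "HOL-Algebra.Free_Abelian_Groups"
begin

text \<open>An edge is the set of its two endpoints.\<close>

definition simple_graph :: "'v set \<Rightarrow> 'v set set \<Rightarrow> bool" where
  "simple_graph V E \<longleftrightarrow> (\<forall>e\<in>E. e \<subseteq> V \<and> card e = 2)"

definition connected_graph :: "'v set \<Rightarrow> 'v set set \<Rightarrow> bool" where
  "connected_graph V E \<longleftrightarrow>
     V \<noteq> {} \<and> (\<forall>u\<in>V. \<forall>v\<in>V. (u, v) \<in> {(x, y). {x, y} \<in> E}\<^sup>*)"

definition admissible_placement :: "'v set set \<Rightarrow> ('v \<Rightarrow> 'a) \<Rightarrow> bool" where
  "admissible_placement E p \<longleftrightarrow> (\<forall>u v. {u, v} \<in> E \<longrightarrow> p u \<noteq> p v)"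

text \<open>\<open>D n\<close> is the \<open>n\<close>-th derivative; the notion is \<open>C\<^sup>\<infinity>\<close>, used for open \<open>S\<close> only.\<close>

definition smooth_curve_on :: "real set \<Rightarrow> (real \<Rightarrow> 'a::real_normed_vector) \<Rightarrow> bool" where
  "smooth_curve_on S f \<longleftrightarrow>
     (\<exists>D :: nat \<Rightarrow> real \<Rightarrow> 'a. (\<forall>t\<in>S. D 0 t = f t) \<and>
        (\<forall>n. \<forall>t\<in>S. (D n has_vector_derivative D (Suc n) t) (at t)))"

definition positive_semidefinite :: "real^'n^'n \<Rightarrow> bool" where
  "positive_semidefinite A \<longleftrightarrow> transpose A = A \<and> (\<forall>x. 0 \<le> x \<bullet> (A *v x))"

definition nonconstant_psd_curve :: "real \<Rightarrow> (real \<Rightarrow> real^'n^'n) \<Rightarrow> bool" where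
  "nonconstant_psd_curve \<epsilon> \<omega> \<longleftrightarrow>
     \<not> \<omega> constant_on {-\<epsilon><..<\<epsilon>} \<and>
     (\<forall>\<tau>\<in>{-\<epsilon><..<\<epsilon>}. positive_semidefinite (vector_derivative \<omega> (at \<tau>)))"

definition is_basis :: "('n::finite \<Rightarrow> real^'n) \<Rightarrow> bool" where
  "is_basis b \<longleftrightarrow> inj b \<and> independent (range b) \<and> span (range b) = UNIV"

definition lattice_generated :: "('n::finite \<Rightarrow> real^'n) \<Rightarrow> (real^'n) set" where
  "lattice_generated b = {\<Sum>k\<in>UNIV. of_int (n k) *\<^sub>R b k |n :: 'n \<Rightarrow> int. True}"

definition full_lattice :: "(real^'n) set \<Rightarrow> bool" where
  "full_lattice S \<longleftrightarrow> (\<exists>b. is_basis b \<and> S = lattice_generated b)"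

definition linkage :: "'v set \<Rightarrow> 'v set set \<Rightarrow> ('v \<Rightarrow> real^'n) \<Rightarrow> bool" where
  "linkage V E p \<longleftrightarrow>
     finite V \<and> simple_graph V E \<and> connected_graph V E \<and> admissible_placement E p"

text \<open>The row of the rigidity matrix at an edge, as a functional of the velocities \<open>q\<close>.\<close>

definition rigidity_row :: "('v \<Rightarrow> real^'n) \<Rightarrow> 'v set \<Rightarrow> ('v \<Rightarrow> real^'n) \<Rightarrow> real" where
  "rigidity_row p e q =
     (THE r. \<exists>u v. e = {u, v} \<and> r = (p u - p v) \<bullet> (q u - q v))"

lemma rigidity_row_edge: "rigidity_row p {u, v} q = (p u - p v) \<bullet> (q u - q v)"
  unfolding rigidity_row_def
proof (rule the_equality)
  fix r
  assume "\<exists>x y. {u, v} = {x, y} \<and> r = (p x - p y) \<bullet> (q x - q y)"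
  then obtain x y where xy: "{u, v} = {x, y}" and r: "r = (p x - p y) \<bullet> (q x - q y)"
    by blast
  have "x = u \<and> y = v \<or> x = v \<and> y = u"
    using xy by (auto simp: doubleton_eq_iff)
  then show "r = (p u - p v) \<bullet> (q u - q v)"
    unfolding r by (auto simp: inner_diff algebra_simps)
qed blast

definition infinitesimally_independent :: "'v set set \<Rightarrow> ('v \<Rightarrow> real^'n) \<Rightarrow> bool" where
  "infinitesimally_independent E p \<longleftrightarrow>
     (\<forall>c :: 'v set \<Rightarrow> real.
        (\<forall>q. (\<Sum>e\<in>E. c e * rigidity_row p e q) = 0) \<longrightarrow> (\<forall>e\<in>E. c e = 0))"

definition linkage_deformation ::
    "'v set \<Rightarrow> 'v set set \<Rightarrow> ('v \<Rightarrow> real^'n) \<Rightarrow> real \<Rightarrow> (real \<Rightarrow> 'v \<Rightarrow> real^'n) \<Rightarrow> bool" where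
  "linkage_deformation V E p \<epsilon> q \<longleftrightarrow>
     \<epsilon> > 0 \<and>
     (\<forall>v\<in>V. q 0 v = p v) \<and>
     (\<forall>v\<in>V. smooth_curve_on {-\<epsilon><..<\<epsilon>} (\<lambda>\<tau>. q \<tau> v)) \<and>
     (\<forall>\<tau>\<in>{-\<epsilon><..<\<epsilon>}. admissible_placement E (q \<tau>) \<and>
        (\<forall>u v. {u, v} \<in> E \<longrightarrow> dist (q \<tau> u) (q \<tau> v) = dist (p u) (p v)))"

text \<open>The group of automorphisms is an abstract group with a faithful action on the vertices.\<close>

record ('w, 'g) periodic_graph =
  pverts :: "'w set"
  pedges :: "'w set set"
  pgroup :: "'g monoid"
  paction :: "'g \<Rightarrow> 'w \<Rightarrow> 'w"

definition d_periodic_graph :: "nat \<Rightarrow> ('w, 'g) periodic_graph \<Rightarrow> bool" where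
  "d_periodic_graph d Q \<longleftrightarrow>
     infinite (pverts Q) \<and> simple_graph (pverts Q) (pedges Q) \<and>
     (\<forall>v\<in>pverts Q. finite {e \<in> pedges Q. v \<in> e}) \<and>
     comm_group (pgroup Q) \<and> pgroup Q \<cong> free_Abelian_group {..<d} \<and>
     faithful_action (pgroup Q) (pverts Q) (paction Q) \<and>
     (\<forall>\<gamma>\<in>carrier (pgroup Q). \<forall>e\<in>pedges Q. paction Q \<gamma> ` e \<in> pedges Q) \<and>
     (\<forall>\<gamma>\<in>carrier (pgroup Q). \<gamma> \<noteq> \<one>\<^bsub>pgroup Q\<^esub> \<longrightarrow>
        (\<forall>v\<in>pverts Q. paction Q \<gamma> v \<noteq> v) \<and> (\<forall>e\<in>pedges Q. paction Q \<gamma> ` e \<noteq> e)) \<and>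
     finite (orbits (pgroup Q) (pverts Q) (paction Q)) \<and>
     finite (orbits (pgroup Q) (pedges Q) (\<lambda>\<gamma> e. paction Q \<gamma> ` e))"

definition vector_group :: "(real^'n) set \<Rightarrow> (real^'n) monoid" where
  "vector_group S = \<lparr>carrier = S, mult = (+), one = 0\<rparr>"

text \<open>A translation is identified with its vector.\<close>

definition periodic_framework ::
    "('w, 'g) periodic_graph \<Rightarrow> ('w \<Rightarrow> real^'n) \<Rightarrow> ('g \<Rightarrow> real^'n) \<Rightarrow> bool" where
  "periodic_framework Q P \<pi> \<longleftrightarrow>
     d_periodic_graph CARD('n) Q \<and>
     \<pi> \<in> hom (pgroup Q) (vector_group UNIV) \<and> inj_on \<pi> (carrier (pgroup Q)) \<and>
     full_lattice (\<pi> ` carrier (pgroup Q)) \<and>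
     (\<forall>\<gamma>\<in>carrier (pgroup Q). \<forall>v\<in>pverts Q. P (paction Q \<gamma> v) = P v + \<pi> \<gamma>) \<and>
     admissible_placement (pedges Q) P"

definition deformation_path ::
    "('w, 'g) periodic_graph \<Rightarrow> ('w \<Rightarrow> real^'n) \<Rightarrow> ('g \<Rightarrow> real^'n) \<Rightarrow>
     real \<Rightarrow> (real \<Rightarrow> 'w \<Rightarrow> real^'n) \<Rightarrow> (real \<Rightarrow> 'g \<Rightarrow> real^'n) \<Rightarrow> bool" where
  "deformation_path Q P \<pi> \<epsilon> P' \<pi>' \<longleftrightarrow>
     \<epsilon> > 0 \<and>
     (\<forall>v\<in>pverts Q. P' 0 v = P v) \<and> (\<forall>\<gamma>\<in>carrier (pgroup Q). \<pi>' 0 \<gamma> = \<pi> \<gamma>) \<and>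
     (\<forall>v\<in>pverts Q. smooth_curve_on {-\<epsilon><..<\<epsilon>} (\<lambda>\<tau>. P' \<tau> v)) \<and>
     (\<forall>\<gamma>\<in>carrier (pgroup Q). smooth_curve_on {-\<epsilon><..<\<epsilon>} (\<lambda>\<tau>. \<pi>' \<tau> \<gamma>)) \<and>
     (\<forall>\<tau>\<in>{-\<epsilon><..<\<epsilon>}. periodic_framework Q (P' \<tau>) (\<pi>' \<tau>) \<and>
        (\<forall>u v. {u, v} \<in> pedges Q \<longrightarrow> dist (P' \<tau> u) (P' \<tau> v) = dist (P u) (P v)))"

definition independent_generators :: "'g monoid \<Rightarrow> ('n::finite \<Rightarrow> 'g) \<Rightarrow> bool" where
  "independent_generators G g \<longleftrightarrow>
     range g \<subseteq> carrier G \<and> generate G (range g) = carrier G \<and>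
     (\<forall>n :: 'n \<Rightarrow> int. (\<Otimes>\<^bsub>G\<^esub>k\<in>UNIV. g k [^]\<^bsub>G\<^esub> n k) = \<one>\<^bsub>G\<^esub> \<longrightarrow> (\<forall>k. n k = 0))"

definition column_matrix :: "('n \<Rightarrow> real^'n) \<Rightarrow> real^'n^'n" where
  "column_matrix b = (\<chi> i k. b k $ i)"

definition framework_gram :: "('n::finite \<Rightarrow> 'g) \<Rightarrow> ('g \<Rightarrow> real^'n) \<Rightarrow> real^'n^'n" where
  "framework_gram g \<pi> =
     transpose (column_matrix (\<lambda>k. \<pi> (g k))) ** column_matrix (\<lambda>k. \<pi> (g k))"

definition has_nontrivial_auxetic_path ::
    "('w, 'g) periodic_graph \<Rightarrow> ('w \<Rightarrow> real^'n) \<Rightarrow> ('g \<Rightarrow> real^'n) \<Rightarrow> ('n::finite \<Rightarrow> 'g) \<Rightarrow> bool" where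
  "has_nontrivial_auxetic_path Q P \<pi> g \<longleftrightarrow>
     (\<exists>\<epsilon> P' \<pi>'. deformation_path Q P \<pi> \<epsilon> P' \<pi>' \<and>
        nonconstant_psd_curve \<epsilon> (\<lambda>\<tau>. framework_gram g (\<pi>' \<tau>)))"

text \<open>The \<open>k\<close>-th marked pair is \<open>{vi k, vj k}\<close>; the marked pairs are indexed by the same
  finite type as the coordinates. The formal symbol \<open>v + \<mu>\<close> is the pair \<open>(v, \<mu>)\<close>.\<close>

definition marked_vector :: "('v \<Rightarrow> real^'n) \<Rightarrow> ('n \<Rightarrow> 'v) \<Rightarrow> ('n \<Rightarrow> 'v) \<Rightarrow> 'n \<Rightarrow> real^'n" where
  "marked_vector p vi vj k = p (vj k) - p (vi k)"

definition marked_gram ::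
    "('v \<Rightarrow> real^'n) \<Rightarrow> ('n \<Rightarrow> 'v) \<Rightarrow> ('n \<Rightarrow> 'v) \<Rightarrow> real^'n^'n" where
  "marked_gram p vi vj = (\<chi> a b. marked_vector p vi vj a \<bullet> marked_vector p vi vj b)"

definition marked_lattice ::
    "('v \<Rightarrow> real^'n) \<Rightarrow> ('n::finite \<Rightarrow> 'v) \<Rightarrow> ('n \<Rightarrow> 'v) \<Rightarrow> (real^'n) set" where
  "marked_lattice p vi vj = lattice_generated (marked_vector p vi vj)"

text \<open>The generating relation is already invariant under translations by lattice vectors,
  hence so is the equivalence relation it generates.\<close>

definition identification ::
    "('v \<Rightarrow> real^'n) \<Rightarrow> ('n::finite \<Rightarrow> 'v) \<Rightarrow> ('n \<Rightarrow> 'v) \<Rightarrow> 'v \<times> (real^'n) \<Rightarrow> 'v \<times> (real^'n) \<Rightarrow> bool" where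
  "identification p vi vj x y \<longleftrightarrow>
     (\<exists>k. \<exists>\<mu>\<in>marked_lattice p vi vj.
        x = (vj k, \<mu>) \<and> y = (vi k, marked_vector p vi vj k + \<mu>))"

definition symbol_rel ::
    "'v set \<Rightarrow> ('v \<Rightarrow> real^'n) \<Rightarrow> ('n::finite \<Rightarrow> 'v) \<Rightarrow> ('n \<Rightarrow> 'v) \<Rightarrow> (('v \<times> (real^'n)) \<times> 'v \<times> (real^'n)) set" where
  "symbol_rel V p vi vj =
     {(x, y). x \<in> V \<times> marked_lattice p vi vj \<and> y \<in> V \<times> marked_lattice p vi vj \<and>
        equivclp (identification p vi vj) x y}"

definition associated_vertices ::
    "'v set \<Rightarrow> ('v \<Rightarrow> real^'n) \<Rightarrow> ('n::finite \<Rightarrow> 'v) \<Rightarrow> ('n \<Rightarrow> 'v) \<Rightarrow> ('v \<times> (real^'n)) set set" where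
  "associated_vertices V p vi vj = (V \<times> marked_lattice p vi vj) // symbol_rel V p vi vj"

definition associated_edges ::
    "'v set \<Rightarrow> 'v set set \<Rightarrow> ('v \<Rightarrow> real^'n) \<Rightarrow> ('n::finite \<Rightarrow> 'v) \<Rightarrow> ('n \<Rightarrow> 'v) \<Rightarrow>
     ('v \<times> (real^'n)) set set set" where
  "associated_edges V E p vi vj =
     {(\<lambda>v. symbol_rel V p vi vj `` {(v, \<mu>)}) ` e |e \<mu>. e \<in> E \<and> \<mu> \<in> marked_lattice p vi vj}"

text \<open>A lattice vector acts on a class of symbols by translating all symbols of the class; the
  action is restricted to the vertex set as group actions in the library are extensional.\<close>

definition associated_graph ::
    "'v set \<Rightarrow> 'v set set \<Rightarrow> ('v \<Rightarrow> real^'n) \<Rightarrow> ('n::finite \<Rightarrow> 'v) \<Rightarrow> ('n \<Rightarrow> 'v) \<Rightarrow>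
     (('v \<times> (real^'n)) set, real^'n) periodic_graph" where
  "associated_graph V E p vi vj =
     \<lparr>pverts = associated_vertices V p vi vj,
      pedges = associated_edges V E p vi vj,
      pgroup = vector_group (marked_lattice p vi vj),
      paction = (\<lambda>\<gamma>. \<lambda>x\<in>associated_vertices V p vi vj. (\<lambda>(v, \<mu>). (v, \<gamma> + \<mu>)) ` x)\<rparr>"

text \<open>All symbols \<open>v + \<mu>\<close> in a class have the same value \<open>p v + \<mu>\<close>.\<close>

definition associated_placement ::
    "('v \<Rightarrow> real^'n) \<Rightarrow> ('v \<times> (real^'n)) set \<Rightarrow> real^'n" where
  "associated_placement p x = the_elem ((\<lambda>(v, \<mu>). p v + \<mu>) ` x)"

definition associated_translation :: "real^'n \<Rightarrow> real^'n" where
  "associated_translation \<gamma> = \<gamma>"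

end

theory Submission
  imports Defs
begin

text \<open>A deformation of the linkage and a deformation of the associated periodic framework carry the same
  data. In the periodic graph the vertex \<open>v\<^sub>j\<close> of the \<open>k\<close>-th marked pair is the translate of \<open>v\<^sub>i\<close> by
  \<open>\<lambda>\<^sub>k\<close>. Given a periodic deformation, restrict it to the symbols \<open>v + 0\<close>
  (\<open>linkage_deformation_restricted\<close>); periodicity says that the \<open>k\<close>-th marked vector of the restriction
  is the period of \<open>\<lambda>\<^sub>k\<close> (\<open>marked_vector_restricted\<close>), and these periods form a basis because the period
  lattice has full rank (\<open>is_basis_translations\<close>). Given a deformation \<open>q\<^sub>\<tau>\<close> of the linkage, let \<open>M\<^sub>\<tau>\<close> be the
  linear map that sends each \<open>\<lambda>\<^sub>k\<close> to the \<open>k\<close>-th marked vector of \<open>q\<^sub>\<tau>\<close>, and place \<open>v + \<mu>\<close> at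
  \<open>q\<^sub>\<tau> v + M\<^sub>\<tau> \<mu>\<close>; this respects the identification of symbols, and each translate of an edge has the same
  edge vector as the edge itself (\<open>deformation_path_lifted\<close>).

  It remains to compare the Gram matrices. Those of the framework belong to arbitrary generators of the
  lattice, those of the linkage to the generators \<open>\<lambda>\<^sub>k\<close>. Integer matrices independent of \<open>\<tau>\<close> express
  each family by the other, so the two curves are related by congruences \<open>W \<mapsto> A W A\<^sup>T\<close> with constant \<open>A\<close>
  in both directions, and these preserve non-constancy and semidefiniteness of the tangents
  (\<open>nonconstant_psd_curve_generators\<close>).

  Most of the remaining work is to check that the associated graph is a periodic graph
  (\<open>d_periodic_graph_associated\<close>). The tool is that all symbols \<open>v + \<mu>\<close> of a class have the same position
  \<open>p v + \<mu>\<close>: it distinguishes the endpoints of an edge, bounds the degrees, and shows that the lattice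
  acts freely.\<close>

section \<open>Smooth curves\<close>

lemma smooth_curve_on_add:
  assumes "smooth_curve_on S f" and "smooth_curve_on S g"
  shows "smooth_curve_on S (\<lambda>t. f t + g t)"
proof -
  obtain D where D: "\<forall>t\<in>S. D 0 t = f t"
    "\<And>n t. t \<in> S \<Longrightarrow> (D n has_vector_derivative D (Suc n) t) (at t)"
    using assms(1) unfolding smooth_curve_on_def by blast
  obtain D' where D': "\<forall>t\<in>S. D' 0 t = g t"
    "\<And>n t. t \<in> S \<Longrightarrow> (D' n has_vector_derivative D' (Suc n) t) (at t)"
    using assms(2) unfolding smooth_curve_on_def by blast
  show ?thesis unfolding smooth_curve_on_def
    by (rule exI[of _ "\<lambda>n t. D n t + D' n t"]) (auto simp: D D' intro!: derivative_intros)
qed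

lemma smooth_curve_on_scaleR:
  assumes "smooth_curve_on S f"
  shows "smooth_curve_on S (\<lambda>t. c *\<^sub>R f t)"
proof -
  obtain D where D: "\<forall>t\<in>S. D 0 t = f t"
    "\<And>n t. t \<in> S \<Longrightarrow> (D n has_vector_derivative D (Suc n) t) (at t)"
    using assms(1) unfolding smooth_curve_on_def by blast
  show ?thesis unfolding smooth_curve_on_def
    by (rule exI[of _ "\<lambda>n t. c *\<^sub>R D n t"])
      (auto simp: D intro!: bounded_linear.has_vector_derivative[OF bounded_linear_scaleR_right])
qed

lemma smooth_curve_on_diff:
  assumes "smooth_curve_on S f" and "smooth_curve_on S g"
  shows "smooth_curve_on S (\<lambda>t. f t - g t)"
  using smooth_curve_on_add[OF assms(1) smooth_curve_on_scaleR[OF assms(2), of "-1"]] by simp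

lemma smooth_curve_on_sum:
  assumes "finite A" and "\<And>i. i \<in> A \<Longrightarrow> smooth_curve_on S (f i)"
  shows "smooth_curve_on S (\<lambda>t. \<Sum>i\<in>A. f i t)"
  using assms
proof (induction A rule: finite_induct)
  case empty
  show ?case unfolding smooth_curve_on_def
    by (rule exI[of _ "\<lambda>n t. 0"]) auto
next
  case (insert i A)
  then show ?case by (simp add: smooth_curve_on_add)
qed

lemma smooth_curve_on_cong:
  assumes "\<And>t. t \<in> S \<Longrightarrow> f t = g t" and "smooth_curve_on S f"
  shows "smooth_curve_on S g"
  using assms unfolding smooth_curve_on_def by auto

lemma smooth_curve_on_differentiable:
  assumes "smooth_curve_on S f" and "open S" and "t \<in> S"
  shows "f differentiable (at t)"
proof -
  obtain D where D: "\<forall>t\<in>S. D 0 t = f t"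
    "\<And>n t. t \<in> S \<Longrightarrow> (D n has_vector_derivative D (Suc n) t) (at t)"
    using assms(1) unfolding smooth_curve_on_def by blast
  have "(f has_vector_derivative D (Suc 0) t) (at t)"
    by (rule has_vector_derivative_transform_within_open[OF D(2)[of t 0] assms(2,3)])
      (use D assms in auto)
  then show ?thesis by (rule differentiableI_vector)
qed

section \<open>Curves of Gram matrices under a change of generators\<close>

definition gram :: "('n::finite \<Rightarrow> real^'n) \<Rightarrow> real^'n^'n" where
  "gram b = (\<chi> i j. b i \<bullet> b j)"

lemma framework_gram_eq: "framework_gram g \<pi> = gram (\<lambda>k. \<pi> (g k))"
  unfolding framework_gram_def gram_def column_matrix_def matrix_matrix_mult_def transpose_def
  by (simp add: inner_vec_def)

lemma marked_gram_eq: "marked_gram q vi vj = gram (marked_vector q vi vj)"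
  unfolding marked_gram_def gram_def ..

text \<open>With the vectors as the columns of a matrix \<open>C\<close> the Gram matrix is \<open>C\<^sup>T C\<close>, and forming linear
  combinations replaces \<open>C\<close> by \<open>C A\<^sup>T\<close>.\<close>

lemma gram_linear_combination:
  fixes b :: "'n::finite \<Rightarrow> real^'n"
  shows "gram (\<lambda>i. \<Sum>k\<in>UNIV. A$i$k *\<^sub>R b k) = A ** gram b ** transpose A"
proof -
  have g: "gram c = transpose (column_matrix c) ** column_matrix c" for c :: "'n \<Rightarrow> real^'n"
    using framework_gram_eq[of c "\<lambda>x. x"] by (simp add: framework_gram_def)
  have "column_matrix (\<lambda>i. \<Sum>k\<in>UNIV. A$i$k *\<^sub>R b k) = column_matrix b ** transpose A"
    by (simp add: column_matrix_def matrix_matrix_mult_def transpose_def vec_eq_iff mult.commute)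
  then show ?thesis
    by (simp add: g matrix_transpose_mul matrix_mul_assoc)
qed

lemma gram_differentiable:
  fixes b :: "real \<Rightarrow> 'n::finite \<Rightarrow> real^'n"
  assumes "\<And>k. (\<lambda>\<tau>. b \<tau> k) differentiable (at t)"
  shows "(\<lambda>\<tau>. gram (b \<tau>)) differentiable (at t)"
  unfolding differentiable_componentwise_within[of "\<lambda>\<tau>. gram (b \<tau>)"]
  by (auto simp: Basis_vec_def gram_def inner_axis intro!: differentiable_inner assms)

text \<open>Moving \<open>A\<close> to the other side of the inner product evaluates the quadratic form of \<open>W\<close> at \<open>A\<^sup>T x\<close>.\<close>

lemma positive_semidefinite_congruence:
  assumes "positive_semidefinite W"
  shows "positive_semidefinite (A ** W ** transpose A)"
proof -
  have W: "transpose W = W" "\<And>x. 0 \<le> x \<bullet> (W *v x)"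
    using assms unfolding positive_semidefinite_def by auto
  have "x \<bullet> ((A ** W ** transpose A) *v x) = (transpose A *v x) \<bullet> (W *v (transpose A *v x))" for x
    by (simp add: matrix_vector_mul_assoc[symmetric] dot_lmul_matrix[symmetric] transpose_matrix_vector)
  then show ?thesis
    using W unfolding positive_semidefinite_def
    by (simp add: matrix_transpose_mul matrix_mul_assoc)
qed

lemma linear_congruence: "linear (\<lambda>W::real^'n^'n. A ** W ** transpose A)"
  by (rule linearI)
    (simp_all add: vec_eq_iff matrix_matrix_mult_def sum.distrib sum_distrib_left sum_distrib_right
      distrib_left distrib_right mult.assoc mult.left_commute)

text \<open>The congruence by a constant matrix is linear, so it commutes with differentiation in \<open>\<tau>\<close> and
  preserves semidefiniteness of the derivative. That the old vectors are, by constant coefficients,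
  combinations of the new ones is what keeps the curve from becoming constant.\<close>

lemma nonconstant_psd_curve_change_of_basis:
  fixes b b' :: "real \<Rightarrow> 'n::finite \<Rightarrow> real^'n"
  assumes smooth: "\<And>k. smooth_curve_on {-\<epsilon><..<\<epsilon>} (\<lambda>\<tau>. b \<tau> k)"
    and b': "\<And>\<tau> i. \<tau> \<in> {-\<epsilon><..<\<epsilon>} \<Longrightarrow> b' \<tau> i = (\<Sum>k\<in>UNIV. A$i$k *\<^sub>R b \<tau> k)"
    and b: "\<And>\<tau> i. \<tau> \<in> {-\<epsilon><..<\<epsilon>} \<Longrightarrow> b \<tau> i = (\<Sum>k\<in>UNIV. B$i$k *\<^sub>R b' \<tau> k)"
    and psd: "nonconstant_psd_curve \<epsilon> (\<lambda>\<tau>. gram (b \<tau>))"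
  shows "nonconstant_psd_curve \<epsilon> (\<lambda>\<tau>. gram (b' \<tau>))"
proof -
  let ?I = "{-\<epsilon><..<\<epsilon>}"
  have eq: "gram (b' \<tau>) = A ** gram (b \<tau>) ** transpose A" if "\<tau> \<in> ?I" for \<tau>
  proof -
    have "b' \<tau> = (\<lambda>i. \<Sum>k\<in>UNIV. A$i$k *\<^sub>R b \<tau> k)"
      using b'[OF that] by blast
    then show ?thesis by (simp only: gram_linear_combination)
  qed
  have eq': "gram (b \<tau>) = B ** gram (b' \<tau>) ** transpose B" if "\<tau> \<in> ?I" for \<tau>
  proof -
    have "b \<tau> = (\<lambda>i. \<Sum>k\<in>UNIV. B$i$k *\<^sub>R b' \<tau> k)"
      using b[OF that] by blast
    then show ?thesis by (simp only: gram_linear_combination)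
  qed
  have "\<not> (\<lambda>\<tau>. gram (b' \<tau>)) constant_on ?I"
  proof
    assume "(\<lambda>\<tau>. gram (b' \<tau>)) constant_on ?I"
    then have "(\<lambda>\<tau>. gram (b \<tau>)) constant_on ?I"
      unfolding constant_on_def using eq' by metis
    then show False using psd unfolding nonconstant_psd_curve_def by blast
  qed
  moreover have "positive_semidefinite (vector_derivative (\<lambda>\<tau>. gram (b' \<tau>)) (at t))"
    if t: "t \<in> ?I" for t
  proof -
    have "(\<lambda>\<tau>. gram (b \<tau>)) differentiable (at t)"
      by (rule gram_differentiable, rule smooth_curve_on_differentiable[OF smooth _ t]) simp
    then have "((\<lambda>\<tau>. gram (b \<tau>)) has_vector_derivative vector_derivative (\<lambda>\<tau>. gram (b \<tau>)) (at t)) (at t)"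
      by (simp add: vector_derivative_works)
    from bounded_linear.has_vector_derivative[OF
        linear_congruence[of A, unfolded linear_conv_bounded_linear] this]
    have "((\<lambda>\<tau>. gram (b' \<tau>)) has_vector_derivative
        A ** vector_derivative (\<lambda>\<tau>. gram (b \<tau>)) (at t) ** transpose A) (at t)"
      by (rule has_vector_derivative_transform_within_open[OF _ _ t]) (auto simp: eq)
    then show ?thesis
      using psd t unfolding nonconstant_psd_curve_def
      by (simp add: vector_derivative_at positive_semidefinite_congruence)
  qed
  ultimately show ?thesis unfolding nonconstant_psd_curve_def by blast
qed

section \<open>Lattices and bases\<close>

lemma lattice_generated_iff:
  "x \<in> lattice_generated b \<longleftrightarrow> (\<exists>n :: 'n::finite \<Rightarrow> int. x = (\<Sum>k\<in>UNIV. of_int (n k) *\<^sub>R b k))"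
  unfolding lattice_generated_def by auto

lemma lattice_generated_add:
  assumes "x \<in> lattice_generated b" and "y \<in> lattice_generated b"
  shows "x + y \<in> lattice_generated b"
proof -
  obtain n m where "x = (\<Sum>k\<in>UNIV. of_int (n k) *\<^sub>R b k)" "y = (\<Sum>k\<in>UNIV. of_int (m k) *\<^sub>R b k)"
    using assms unfolding lattice_generated_iff by blast
  then have "x + y = (\<Sum>k\<in>UNIV. of_int (n k + m k) *\<^sub>R b k)"
    by (simp add: scaleR_add_left sum.distrib)
  then show ?thesis unfolding lattice_generated_iff by fast
qed

lemma lattice_generated_uminus:
  assumes "x \<in> lattice_generated b"
  shows "- x \<in> lattice_generated b"
proof -
  obtain n where "x = (\<Sum>k\<in>UNIV. of_int (n k) *\<^sub>R b k)"
    using assms unfolding lattice_generated_iff by blast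
  then have "- x = (\<Sum>k\<in>UNIV. of_int (- n k) *\<^sub>R b k)"
    by (simp add: sum_negf)
  then show ?thesis unfolding lattice_generated_iff by fast
qed

lemma lattice_generated_0: "0 \<in> lattice_generated b"
  unfolding lattice_generated_iff by (rule exI[of _ "\<lambda>k. 0"]) simp

lemma lattice_generated_generator: "b k \<in> lattice_generated b"
proof -
  have "(\<Sum>j\<in>UNIV. of_int (if j = k then 1 else 0) *\<^sub>R b j) = b k"
    by (simp add: if_distrib[of "\<lambda>i. of_int i *\<^sub>R _"] cong: if_cong)
  then show ?thesis unfolding lattice_generated_iff by metis
qed

lemma lattice_generated_of_int:
  assumes "x \<in> lattice_generated b"
  shows "of_int m *\<^sub>R x \<in> lattice_generated b"
proof -
  obtain n where "x = (\<Sum>k\<in>UNIV. of_int (n k) *\<^sub>R b k)"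
    using assms unfolding lattice_generated_iff by blast
  then have "of_int m *\<^sub>R x = (\<Sum>k\<in>UNIV. of_int (m * n k) *\<^sub>R b k)"
    by (simp add: scaleR_sum_right)
  then show ?thesis unfolding lattice_generated_iff by fast
qed

lemma lattice_generated_sum:
  assumes "finite A" and "\<And>k. k \<in> A \<Longrightarrow> f k \<in> lattice_generated b"
  shows "(\<Sum>k\<in>A. f k) \<in> lattice_generated b"
  using assms by (induction A rule: finite_induct) (auto simp: lattice_generated_0 lattice_generated_add)

lemma lattice_generated_subset_span: "lattice_generated b \<subseteq> span (range b)"
proof
  fix x assume "x \<in> lattice_generated b"
  then obtain n where "x = (\<Sum>k\<in>UNIV. of_int (n k) *\<^sub>R b k)"
    unfolding lattice_generated_iff by blast
  then show "x \<in> span (range b)"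
    by (auto intro: span_sum span_scale span_base)
qed

lemma is_basis_combination_0:
  assumes "is_basis b" and "(\<Sum>k\<in>UNIV. c k *\<^sub>R b k) = 0"
  shows "c k = 0"
proof -
  have inj: "inj b" and ind: "independent (range b)" using assms unfolding is_basis_def by auto
  have "(\<Sum>x\<in>range b. c (inv_into UNIV b x) *\<^sub>R x) = (\<Sum>k\<in>UNIV. c k *\<^sub>R b k)"
    using inj by (simp add: sum.reindex)
  then have "(\<Sum>x\<in>range b. c (inv_into UNIV b x) *\<^sub>R x) = 0" using assms by simp
  then have "c (inv_into UNIV b (b k)) = 0"
    using independentD[OF ind _ subset_refl, of "\<lambda>x. c (inv_into UNIV b x)" "b k"] by auto
  then show ?thesis using inj by simp
qed

lemma is_basis_of_int_combination_inj:
  assumes "is_basis b" and "(\<Sum>k\<in>UNIV. of_int (n k) *\<^sub>R b k) = (\<Sum>k\<in>UNIV. of_int (m k) *\<^sub>R b k)"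
  shows "n = m"
proof
  fix k
  have "(\<Sum>k\<in>UNIV. of_int (n k - m k) *\<^sub>R b k) = 0"
    using assms by (simp add: scaleR_diff_left sum_subtractf)
  then have "of_int (n k - m k) = (0::real)"
    using is_basis_combination_0[OF assms(1), of "\<lambda>k. of_int (n k - m k)"] by blast
  then show "n k = m k" by simp
qed

text \<open>The index type has as many elements as the space has dimensions, so a spanning family can neither
  repeat a vector nor be dependent.\<close>

lemma is_basis_if_span:
  fixes b :: "'n::finite \<Rightarrow> real^'n"
  assumes "span (range b) = UNIV"
  shows "is_basis b"
proof -
  have le: "card (range b) \<le> CARD('n)" by (rule card_image_le) simp
  have "CARD('n) = dim (UNIV :: (real^'n) set)" by (simp add: dim_UNIV)
  moreover have "dim (UNIV :: (real^'n) set) \<le> card (range b)"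
    by (rule dim_le_card) (simp_all add: assms)
  ultimately have c: "card (range b) = CARD('n)" using le by simp
  have "inj b" by (rule eq_card_imp_inj_on) (simp_all add: c)
  moreover have "independent (range b)"
    by (rule card_le_dim_spanning[of _ UNIV]) (use assms c in \<open>simp_all add: dim_UNIV\<close>)
  ultimately show ?thesis using assms unfolding is_basis_def by simp
qed

text \<open>The linear map carrying the basis \<open>b\<close> to \<open>c\<close>. The coordinates are spelled out because, for fixed
  \<open>x\<close>, this makes the value visibly a fixed linear combination of the vectors \<open>c k\<close>, hence smooth
  when these vectors move smoothly.\<close>

definition basis_map :: "('n::finite \<Rightarrow> real^'n) \<Rightarrow> ('n \<Rightarrow> real^'n) \<Rightarrow> real^'n \<Rightarrow> real^'n" where
  "basis_map b c x = (\<Sum>k\<in>UNIV. representation (range b) x (b k) *\<^sub>R c k)"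

lemma linear_basis_map: "is_basis b \<Longrightarrow> linear (basis_map b c)"
  unfolding is_basis_def
  by (intro linearI)
    (simp_all add: basis_map_def representation_add representation_scale scaleR_add_left
      sum.distrib scaleR_sum_right)

lemma basis_map_basis: "is_basis b \<Longrightarrow> basis_map b c (b j) = c j"
  unfolding is_basis_def basis_map_def
  by (simp add: representation_basis inj_eq if_distrib[of "\<lambda>i. i *\<^sub>R _"] cong: if_cong)

lemma basis_map_of_int_combination:
  "is_basis b \<Longrightarrow>
    basis_map b c (\<Sum>k\<in>UNIV. of_int (n k) *\<^sub>R b k) = (\<Sum>k\<in>UNIV. of_int (n k) *\<^sub>R c k)"
  using linear_basis_map[of b c] by (simp add: linear_sum linear_scale basis_map_basis)

lemma basis_map_self: "is_basis b \<Longrightarrow> basis_map b b x = x"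
proof -
  assume b: "is_basis b"
  have "basis_map b b x = id x"
    by (rule linear_eq_on_span[OF linear_basis_map[OF b] linear_id, of "range b"])
      (use b in \<open>auto simp: basis_map_basis is_basis_def\<close>)
  then show ?thesis by simp
qed

lemma basis_map_image_lattice:
  assumes "is_basis b"
  shows "basis_map b c ` lattice_generated b = lattice_generated c"
  using assms unfolding lattice_generated_def
  by (force simp: basis_map_of_int_combination image_iff)

lemma inj_basis_map_lattice:
  assumes "is_basis b" and "is_basis c"
  shows "inj_on (basis_map b c) (lattice_generated b)"
proof (rule inj_onI)
  fix x y assume "x \<in> lattice_generated b" "y \<in> lattice_generated b"
    and eq: "basis_map b c x = basis_map b c y"
  then obtain n m where "x = (\<Sum>k\<in>UNIV. of_int (n k) *\<^sub>R b k)" "y = (\<Sum>k\<in>UNIV. of_int (m k) *\<^sub>R b k)"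
    unfolding lattice_generated_iff by blast
  then show "x = y"
    using eq is_basis_of_int_combination_inj[OF assms(2), of n m]
    by (simp add: basis_map_of_int_combination[OF assms(1)])
qed

section \<open>Lattices as groups\<close>

lemma comm_group_lattice: "comm_group (vector_group (lattice_generated b))"
  by (rule comm_groupI)
    (auto simp: vector_group_def lattice_generated_0 lattice_generated_add algebra_simps
      intro!: bexI[of _ "- _"] lattice_generated_uminus)

lemma inv_lattice:
  "x \<in> lattice_generated b \<Longrightarrow> inv\<^bsub>vector_group (lattice_generated b)\<^esub> x = - x"
  using comm_group_lattice[of b]
  by (intro group.inv_equality)
    (auto simp: comm_group_def vector_group_def lattice_generated_uminus)

text \<open>Expresses every element of the generated subgroup with integer coefficients; these coefficients
  are the entries of the matrix by which two sets of generators of one lattice are related.\<close>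

lemma generate_subset_lattice_generated:
  assumes "range g \<subseteq> lattice_generated b"
  shows "generate (vector_group (lattice_generated b)) (range g) \<subseteq> lattice_generated g"
proof
  fix x assume "x \<in> generate (vector_group (lattice_generated b)) (range g)"
  then show "x \<in> lattice_generated g"
  proof (induction rule: generate.induct)
    case one
    then show ?case by (simp add: vector_group_def lattice_generated_0)
  next
    case (incl h)
    then show ?case by (auto simp: lattice_generated_generator)
  next
    case (inv h)
    then show ?case using assms
      by (auto simp: inv_lattice lattice_generated_uminus lattice_generated_generator)
  next
    case (eng h1 h2)
    then show ?case by (simp add: vector_group_def lattice_generated_add)
  qed
qed

lemma hom_lattice_add:
  assumes "\<pi> \<in> hom (vector_group (lattice_generated b)) (vector_group UNIV)"
    and "x \<in> lattice_generated b" and "y \<in> lattice_generated b"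
  shows "\<pi> (x + y) = \<pi> x + \<pi> y"
  using assms by (simp add: hom_def vector_group_def)

lemma hom_lattice_0:
  assumes "\<pi> \<in> hom (vector_group (lattice_generated b)) (vector_group UNIV)"
  shows "\<pi> 0 = 0"
  using hom_lattice_add[OF assms lattice_generated_0 lattice_generated_0] by simp

lemma hom_lattice_of_int:
  assumes h: "\<pi> \<in> hom (vector_group (lattice_generated b)) (vector_group UNIV)"
    and x: "x \<in> lattice_generated b"
  shows "\<pi> (of_int m *\<^sub>R x) = of_int m *\<^sub>R \<pi> x"
proof (induction m rule: int_induct[of _ 0])
  case base
  show ?case by (simp add: hom_lattice_0[OF h])
next
  case (step1 i)
  have "of_int (i + 1) *\<^sub>R x = of_int i *\<^sub>R x + x" by (simp add: scaleR_add_left)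
  then show ?case
    using step1 hom_lattice_add[OF h lattice_generated_of_int[OF x, of i] x]
    by (simp add: scaleR_add_left)
next
  case (step2 i)
  have "of_int i *\<^sub>R x = of_int (i - 1) *\<^sub>R x + x" by (simp add: scaleR_diff_left)
  then have "\<pi> (of_int i *\<^sub>R x) = \<pi> (of_int (i - 1) *\<^sub>R x) + \<pi> x"
    using hom_lattice_add[OF h lattice_generated_of_int[OF x, of "i - 1"] x] by simp
  then show ?case using step2 by (simp add: scaleR_diff_left)
qed

text \<open>Additivity alone yields integer combinations, which is all that relations between
  lattice vectors involve; so such relations carry over to the periods.\<close>

lemma hom_lattice_combination:
  assumes h: "\<pi> \<in> hom (vector_group (lattice_generated b)) (vector_group UNIV)"
    and x: "\<And>k. x k \<in> lattice_generated b" and "finite A"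
  shows "\<pi> (\<Sum>k\<in>A. of_int (n k) *\<^sub>R x k) = (\<Sum>k\<in>A. of_int (n k) *\<^sub>R \<pi> (x k))"
  using \<open>finite A\<close>
proof (induction A rule: finite_induct)
  case empty
  show ?case by (simp add: hom_lattice_0[OF h])
next
  case (insert k A)
  then show ?case
    using hom_lattice_add[OF h lattice_generated_of_int[OF x] lattice_generated_sum[OF insert(1)],
        of "\<lambda>k. of_int (n k) *\<^sub>R x k" "n k" k]
    by (simp add: x lattice_generated_of_int hom_lattice_of_int[OF h x])
qed

text \<open>Integer coordinates with respect to a basis are unique. The bijection \<open>h\<close> numbers the
  index type, as the free group is indexed by an initial segment of the naturals.\<close>

lemma lattice_iso_free_Abelian_group:
  fixes b :: "'n::finite \<Rightarrow> real^'n"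
  assumes b: "is_basis b"
  shows "vector_group (lattice_generated b) \<cong> free_Abelian_group {..<CARD('n)}"
proof -
  obtain h where h: "bij_betw h {..<CARD('n)} (UNIV::'n set)"
    using ex_bij_betw_nat_finite[of "UNIV::'n set"] by (auto simp: atLeast0LessThan)
  define r where "r = inv_into {..<CARD('n)} h"
  have r: "r k < CARD('n)" "h (r k) = k" for k
    using inv_into_into[of k h "{..<CARD('n)}"] f_inv_into_f[of k h "{..<CARD('n)}"] h
    by (auto simp: r_def bij_betw_def)
  have rh: "r (h i) = i" if "i < CARD('n)" for i
    using h that unfolding r_def bij_betw_def by simp
  let ?F = "free_Abelian_group {..<CARD('n)}"
  define f where "f c = (\<Sum>k\<in>UNIV. of_int (Poly_Mapping.lookup c (r k)) *\<^sub>R b k)" for c :: "nat \<Rightarrow>\<^sub>0 int"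
  have hom: "f \<in> hom ?F (vector_group (lattice_generated b))"
    by (auto simp: hom_def free_Abelian_group_def vector_group_def f_def lattice_generated_iff
        lookup_add scaleR_add_left sum.distrib)
  have surj: "x \<in> f ` carrier ?F" if x: "x \<in> lattice_generated b" for x
  proof -
    obtain n where n: "x = (\<Sum>k\<in>UNIV. of_int (n k) *\<^sub>R b k)"
      using x unfolding lattice_generated_iff by blast
    define c where "c = Abs_poly_mapping (\<lambda>i. if i < CARD('n) then n (h i) else 0)"
    have l: "Poly_Mapping.lookup c = (\<lambda>i. if i < CARD('n) then n (h i) else 0)"
      unfolding c_def by (rule lookup_Abs_poly_mapping) (auto intro: finite_subset[of _ "{..<CARD('n)}"])
    have "c \<in> carrier ?F"
      by (auto simp: free_Abelian_group_def in_keys_iff l split: if_splits)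
    moreover have "f c = x" by (simp add: f_def l r n)
    ultimately show ?thesis by blast
  qed
  have inj: "inj_on f (carrier ?F)"
  proof (rule inj_onI)
    fix c d assume cd: "c \<in> carrier ?F" "d \<in> carrier ?F" "f c = f d"
    have eq: "(\<lambda>k. Poly_Mapping.lookup c (r k)) = (\<lambda>k. Poly_Mapping.lookup d (r k))"
      by (rule is_basis_of_int_combination_inj[OF b]) (use cd(3) in \<open>simp add: f_def\<close>)
    show "c = d"
    proof (rule poly_mapping_eqI)
      fix i
      show "Poly_Mapping.lookup c i = Poly_Mapping.lookup d i"
      proof (cases "i < CARD('n)")
        case True
        then show ?thesis using fun_cong[OF eq, of "h i"] by (simp add: rh)
      next
        case False
        then have "i \<notin> Poly_Mapping.keys c" "i \<notin> Poly_Mapping.keys d"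
          using cd by (auto simp: free_Abelian_group_def)
        then show ?thesis by (simp add: in_keys_iff)
      qed
    qed
  qed
  have "f \<in> iso ?F (vector_group (lattice_generated b))"
    unfolding iso_iff using hom surj inj hom_carrier[OF hom] by (auto simp: vector_group_def)
  then have "?F \<cong> vector_group (lattice_generated b)" unfolding is_iso_def by blast
  then show ?thesis by (rule group.iso_sym[OF group_free_Abelian_group])
qed

text \<open>Two sets of generators of a lattice are integer combinations of each other, with coefficients
  that do not depend on \<open>\<tau>\<close>, and homomorphisms keep these relations. So the auxetic condition can be
  tested on either set.\<close>

lemma nonconstant_psd_curve_generators:
  fixes g b :: "'n::finite \<Rightarrow> real^'n" and \<pi> :: "real \<Rightarrow> real^'n \<Rightarrow> real^'n"
  assumes g: "independent_generators (vector_group (lattice_generated b)) g"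
    and hom: "\<And>\<tau>. \<tau> \<in> {-\<epsilon><..<\<epsilon>} \<Longrightarrow>
      \<pi> \<tau> \<in> hom (vector_group (lattice_generated b)) (vector_group UNIV)"
    and smooth: "\<And>x. x \<in> lattice_generated b \<Longrightarrow> smooth_curve_on {-\<epsilon><..<\<epsilon>} (\<lambda>\<tau>. \<pi> \<tau> x)"
    and c: "\<And>\<tau> k. \<tau> \<in> {-\<epsilon><..<\<epsilon>} \<Longrightarrow> c \<tau> k = \<pi> \<tau> (b k)"
  shows "nonconstant_psd_curve \<epsilon> (\<lambda>\<tau>. framework_gram g (\<pi> \<tau>)) \<longleftrightarrow>
    nonconstant_psd_curve \<epsilon> (\<lambda>\<tau>. gram (c \<tau>))"
proof -
  let ?L = "lattice_generated b" and ?I = "{-\<epsilon><..<\<epsilon>}"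
  have gL: "range g \<subseteq> ?L" and gen: "generate (vector_group ?L) (range g) = ?L"
    using g unfolding independent_generators_def by (auto simp: vector_group_def)
  have "\<exists>n. g i = (\<Sum>k\<in>UNIV. of_int (n k) *\<^sub>R b k)" for i
    using gL lattice_generated_iff by blast
  then obtain n where n: "\<And>i. g i = (\<Sum>k\<in>UNIV. of_int (n i k) *\<^sub>R b k)" by metis
  have "\<exists>m. b i = (\<Sum>k\<in>UNIV. of_int (m k) *\<^sub>R g k)" for i
    using generate_subset_lattice_generated[OF gL] lattice_generated_generator[of b i]
    unfolding gen lattice_generated_iff[of _ g, symmetric] by blast
  then obtain m where m: "\<And>i. b i = (\<Sum>k\<in>UNIV. of_int (m i k) *\<^sub>R g k)" by metis
  define A :: "real^'n^'n" where "A = (\<chi> i k. of_int (n i k))"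
  define B :: "real^'n^'n" where "B = (\<chi> i k. of_int (m i k))"
  have gk: "g k \<in> ?L" for k using gL by blast
  have A: "\<pi> \<tau> (g i) = (\<Sum>k\<in>UNIV. A$i$k *\<^sub>R c \<tau> k)" if "\<tau> \<in> ?I" for \<tau> i
    using hom_lattice_combination[OF hom[OF that], of b UNIV "n i"] c[OF that]
    by (simp add: A_def n[of i] lattice_generated_generator)
  have B: "c \<tau> i = (\<Sum>k\<in>UNIV. B$i$k *\<^sub>R \<pi> \<tau> (g k))" if "\<tau> \<in> ?I" for \<tau> i
    using hom_lattice_combination[OF hom[OF that], of g UNIV "m i"] c[OF that] m[of i]
    by (simp add: B_def gk)
  have smooth_g: "smooth_curve_on ?I (\<lambda>\<tau>. \<pi> \<tau> (g k))" for k
    by (rule smooth[OF gk])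
  have smooth_c: "smooth_curve_on ?I (\<lambda>\<tau>. c \<tau> k)" for k
    by (rule smooth_curve_on_cong[OF _ smooth[OF lattice_generated_generator[of b k]]])
      (rule c[symmetric])
  show ?thesis
    unfolding framework_gram_eq
    using nonconstant_psd_curve_change_of_basis[OF smooth_g B A]
      nonconstant_psd_curve_change_of_basis[OF smooth_c A B] by blast
qed

section \<open>The associated periodic graph\<close>

locale marked_linkage =
  fixes V :: "'v set" and E :: "'v set set" and p :: "'v \<Rightarrow> real^'n"
    and vi vj :: "'n::finite \<Rightarrow> 'v"
  assumes linkage: "linkage V E p"
    and vi_in: "range vi \<subseteq> V" and vj_in: "range vj \<subseteq> V"
    and basis: "is_basis (marked_vector p vi vj)"
begin

text \<open>In names below, \<open>GL\<close> stands for the associated periodic graph, \<open>VL\<close> and \<open>EL\<close> for its vertices and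
  edges.\<close>

abbreviation "lam \<equiv> marked_vector p vi vj"

abbreviation "\<Lambda> \<equiv> marked_lattice p vi vj"

abbreviation "R \<equiv> symbol_rel V p vi vj"

abbreviation "VL \<equiv> associated_vertices V p vi vj"

abbreviation "EL \<equiv> associated_edges V E p vi vj"

abbreviation "GL \<equiv> associated_graph V E p vi vj"

abbreviation cls :: "'v \<Rightarrow> real^'n \<Rightarrow> ('v \<times> (real^'n)) set" where
  "cls v \<mu> \<equiv> R `` {(v, \<mu>)}"

lemma lattice_closed:
  shows lattice_add: "x \<in> \<Lambda> \<Longrightarrow> y \<in> \<Lambda> \<Longrightarrow> x + y \<in> \<Lambda>"
    and lattice_uminus: "x \<in> \<Lambda> \<Longrightarrow> - x \<in> \<Lambda>"
    and lattice_diff: "x \<in> \<Lambda> \<Longrightarrow> y \<in> \<Lambda> \<Longrightarrow> x - y \<in> \<Lambda>"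
    and lattice_0: "0 \<in> \<Lambda>"
    and lattice_generator: "lam k \<in> \<Lambda>"
  unfolding marked_lattice_def
  using lattice_generated_add[of x lam "- y"]
  by (auto simp: lattice_generated_add lattice_generated_uminus lattice_generated_0
      lattice_generated_generator)

lemma equiv_R: "equiv (V \<times> \<Lambda>) R"
proof (rule equivI)
  show "trans R"
    unfolding symbol_rel_def by (rule transI) (auto intro: equivclp_trans)
  show "sym R"
    unfolding symbol_rel_def by (rule symI) (auto intro: equivclp_sym)
qed (auto simp: symbol_rel_def refl_on_def)

lemma cls_in: "v \<in> V \<Longrightarrow> \<mu> \<in> \<Lambda> \<Longrightarrow> cls v \<mu> \<in> VL"
  unfolding associated_vertices_def by (auto intro: quotientI)

lemma VL_cases:
  assumes "x \<in> VL"
  obtains v \<mu> where "v \<in> V" "\<mu> \<in> \<Lambda>" "x = cls v \<mu>"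
  using assms unfolding associated_vertices_def by (auto elim!: quotientE)

lemma self_in_cls: "v \<in> V \<Longrightarrow> \<mu> \<in> \<Lambda> \<Longrightarrow> (v, \<mu>) \<in> cls v \<mu>"
  using equiv_class_self[OF equiv_R] by blast

lemma cls_marked: "\<mu> \<in> \<Lambda> \<Longrightarrow> cls (vj k) \<mu> = cls (vi k) (lam k + \<mu>)"
proof -
  assume \<mu>: "\<mu> \<in> \<Lambda>"
  have "identification p vi vj (vj k, \<mu>) (vi k, lam k + \<mu>)"
    using \<mu> unfolding identification_def by blast
  then have "((vj k, \<mu>), (vi k, lam k + \<mu>)) \<in> R"
    using \<mu> vi_in vj_in by (auto simp: symbol_rel_def lattice_closed)
  then show ?thesis by (rule equiv_class_eq[OF equiv_R])
qed

text \<open>Functions on symbols that respect the identification of \<open>v\<^sub>j + \<mu>\<close> with \<open>v\<^sub>i + \<lambda>\<^sub>k + \<mu>\<close> descend to the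
  vertices of the periodic graph; placements are obtained in this way.\<close>

lemma symbol_rel_invariant:
  assumes "\<And>k \<mu>. \<mu> \<in> \<Lambda> \<Longrightarrow> F (vj k, \<mu>) = F (vi k, lam k + \<mu>)" and "(x, y) \<in> R"
  shows "F x = F y"
proof -
  have "equivclp (identification p vi vj) x y" using assms(2) unfolding symbol_rel_def by simp
  then show ?thesis
    by (induction rule: equivclp_induct) (use assms(1) in \<open>force simp: identification_def\<close>)+
qed

lemma symbol_rel_shift:
  assumes "((v, \<mu>), (w, \<nu>)) \<in> R" and \<gamma>: "\<gamma> \<in> \<Lambda>"
  shows "((v, \<gamma> + \<mu>), (w, \<gamma> + \<nu>)) \<in> R"
proof -
  let ?s = "\<lambda>x. (fst x, \<gamma> + snd x)"
  have shift_step: "identification p vi vj (?s x) (?s y)" if xy: "identification p vi vj x y" for x y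
  proof -
    obtain k \<mu> where "\<mu> \<in> \<Lambda>" "x = (vj k, \<mu>)" "y = (vi k, lam k + \<mu>)"
      using xy unfolding identification_def by blast
    then show ?thesis
      unfolding identification_def
      by (intro exI[of _ k] bexI[of _ "\<gamma> + \<mu>"]) (auto simp: lattice_add \<gamma> algebra_simps)
  qed
  have "equivclp (identification p vi vj) (v, \<mu>) (w, \<nu>)"
    using assms unfolding symbol_rel_def by simp
  then have "equivclp (identification p vi vj) (?s (v, \<mu>)) (?s (w, \<nu>))"
  proof (induction rule: equivclp_induct)
    case base
    show ?case by simp
  next
    case (step y z)
    then show ?case using shift_step by (blast intro: equivclp_into_equivclp)
  qed
  then show ?thesis using assms unfolding symbol_rel_def by (auto simp: lattice_add)
qed

text \<open>The inclusion from right to left is the shift by \<open>- \<gamma>\<close>.\<close>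

lemma shift_cls:
  assumes "v \<in> V" and "\<mu> \<in> \<Lambda>" and \<gamma>: "\<gamma> \<in> \<Lambda>"
  shows "(\<lambda>(v, \<mu>). (v, \<gamma> + \<mu>)) ` cls v \<mu> = cls v (\<gamma> + \<mu>)"
proof
  show "(\<lambda>(v, \<mu>). (v, \<gamma> + \<mu>)) ` cls v \<mu> \<subseteq> cls v (\<gamma> + \<mu>)"
    using symbol_rel_shift[OF _ \<gamma>] by auto
  show "cls v (\<gamma> + \<mu>) \<subseteq> (\<lambda>(v, \<mu>). (v, \<gamma> + \<mu>)) ` cls v \<mu>"
  proof
    fix y assume "y \<in> cls v (\<gamma> + \<mu>)"
    then obtain w \<nu> where y: "y = (w, \<nu>)" "((v, \<gamma> + \<mu>), (w, \<nu>)) \<in> R" by (cases y) auto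
    from symbol_rel_shift[OF y(2) lattice_uminus[OF \<gamma>]]
    have "(w, - \<gamma> + \<nu>) \<in> cls v \<mu>" by simp
    then show "y \<in> (\<lambda>(v, \<mu>). (v, \<gamma> + \<mu>)) ` cls v \<mu>"
      by (rule rev_image_eqI) (simp add: y)
  qed
qed

text \<open>The periodic placement determined by a placement \<open>q\<close> of the linkage: the marked pairs of \<open>q\<close> span
  the new period lattice, so the symbol \<open>v + \<mu>\<close> goes to \<open>q v\<close> translated by the image of \<open>\<mu>\<close> under
  the linear map \<open>\<lambda>\<^sub>k \<mapsto> q v\<^sub>j - q v\<^sub>i\<close>.\<close>

definition lifted_placement :: "('v \<Rightarrow> real^'n) \<Rightarrow> ('v \<times> (real^'n)) set \<Rightarrow> real^'n" where
  "lifted_placement q x =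
     the_elem ((\<lambda>(v, \<mu>). q v + basis_map lam (marked_vector q vi vj) \<mu>) ` x)"

text \<open>Well defined: \<open>\<mu>\<close> and \<open>\<lambda>\<^sub>k + \<mu>\<close> have images that differ by \<open>q v\<^sub>j - q v\<^sub>i\<close>, exactly as the
  positions of \<open>v\<^sub>i\<close> and \<open>v\<^sub>j\<close> do.\<close>

lemma lifted_placement_cls:
  assumes "v \<in> V" and "\<mu> \<in> \<Lambda>"
  shows "lifted_placement q (cls v \<mu>) = q v + basis_map lam (marked_vector q vi vj) \<mu>"
proof -
  let ?F = "\<lambda>(v, \<mu>). q v + basis_map lam (marked_vector q vi vj) \<mu>"
  have "?F (vj k, \<nu>) = ?F (vi k, lam k + \<nu>)" for k \<nu>
    by (simp add: linear_add[OF linear_basis_map[OF basis]] basis_map_basis[OF basis])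
      (simp add: marked_vector_def)
  then have "?F y = ?F (v, \<mu>)" if "y \<in> cls v \<mu>" for y
    using symbol_rel_invariant[of ?F "(v, \<mu>)" y] that by auto
  then have "?F ` cls v \<mu> = {?F (v, \<mu>)}"
    using self_in_cls[OF assms] by blast
  then show ?thesis unfolding lifted_placement_def by simp
qed

lemma associated_placement_eq_lifted: "associated_placement p = lifted_placement p"
  unfolding associated_placement_def lifted_placement_def by (simp add: basis_map_self[OF basis])

lemma associated_placement_cls:
  "v \<in> V \<Longrightarrow> \<mu> \<in> \<Lambda> \<Longrightarrow> associated_placement p (cls v \<mu>) = p v + \<mu>"
  by (simp add: associated_placement_eq_lifted lifted_placement_cls basis_map_self[OF basis])

lemma pgroup_GL: "pgroup GL = vector_group \<Lambda>"
  and pverts_GL: "pverts GL = VL"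
  and pedges_GL: "pedges GL = EL"
  by (simp_all add: associated_graph_def)

lemma carrier_GL: "carrier (pgroup GL) = \<Lambda>"
  by (simp add: pgroup_GL vector_group_def)

lemma paction_cls:
  "v \<in> V \<Longrightarrow> \<mu> \<in> \<Lambda> \<Longrightarrow> \<gamma> \<in> \<Lambda> \<Longrightarrow> paction GL \<gamma> (cls v \<mu>) = cls v (\<gamma> + \<mu>)"
  by (simp add: associated_graph_def cls_in shift_cls)

lemma edge_in_V: "{u, v} \<in> E \<Longrightarrow> u \<in> V \<and> v \<in> V"
  using linkage unfolding linkage_def simple_graph_def by fastforce

lemma E_cases:
  assumes "e \<in> E"
  obtains u v where "e = {u, v}" "u \<in> V" "v \<in> V" "u \<noteq> v"
proof -
  have "card e = 2" "e \<subseteq> V" using assms linkage unfolding linkage_def simple_graph_def by auto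
  then show thesis using that by (auto simp: card_2_iff)
qed

lemma EL_I: "{u, v} \<in> E \<Longrightarrow> \<mu> \<in> \<Lambda> \<Longrightarrow> {cls u \<mu>, cls v \<mu>} \<in> EL"
  unfolding associated_edges_def by (rule CollectI, rule exI[of _ "{u, v}"], rule exI[of _ \<mu>]) simp

lemma EL_cases:
  assumes "e \<in> EL"
  obtains u v \<mu> where "{u, v} \<in> E" "u \<in> V" "v \<in> V" "\<mu> \<in> \<Lambda>" "e = {cls u \<mu>, cls v \<mu>}"
proof -
  obtain e' \<mu> where e': "e' \<in> E" "\<mu> \<in> \<Lambda>" "e = (\<lambda>v. cls v \<mu>) ` e'"
    using assms unfolding associated_edges_def by blast
  obtain u v where "e' = {u, v}" "u \<in> V" "v \<in> V" using E_cases[OF e'(1)] by metis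
  then show thesis using that[of u v \<mu>] e' by simp
qed

lemma EL_doubleton_cases:
  assumes "{x, y} \<in> EL"
  obtains u v \<mu> where "{u, v} \<in> E" "u \<in> V" "v \<in> V" "\<mu> \<in> \<Lambda>" "x = cls u \<mu>" "y = cls v \<mu>"
proof -
  obtain u v \<mu> where *: "{u, v} \<in> E" "u \<in> V" "v \<in> V" "\<mu> \<in> \<Lambda>" "{x, y} = {cls u \<mu>, cls v \<mu>}"
    using EL_cases[OF assms] .
  then consider "x = cls u \<mu>" "y = cls v \<mu>" | "x = cls v \<mu>" "y = cls u \<mu>"
    by (auto simp: doubleton_eq_iff)
  then show thesis
    using that[of u v \<mu>] that[of v u \<mu>] * by cases (auto simp: insert_commute)
qed

lemma lifted_placement_edge:
  "{u, v} \<in> E \<Longrightarrow> \<mu> \<in> \<Lambda> \<Longrightarrow>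
    lifted_placement q (cls u \<mu>) - lifted_placement q (cls v \<mu>) = q u - q v"
  using edge_in_V by (simp add: lifted_placement_cls)

lemma admissible_associated_placement: "admissible_placement EL (associated_placement p)"
  unfolding admissible_placement_def
proof (intro allI impI)
  fix x y assume "{x, y} \<in> EL"
  then obtain u v \<mu> where *: "{u, v} \<in> E" "\<mu> \<in> \<Lambda>" "x = cls u \<mu>" "y = cls v \<mu>"
    by (rule EL_doubleton_cases)
  then have "p u \<noteq> p v"
    using linkage unfolding linkage_def admissible_placement_def by blast
  then show "associated_placement p x \<noteq> associated_placement p y"
    using lifted_placement_edge[OF *(1,2), of p] * by (auto simp: associated_placement_eq_lifted)
qed

lemma finite_V: "finite V" and finite_E: "finite E" and V_nonempty: "V \<noteq> {}"
proof -
  show V: "finite V" using linkage unfolding linkage_def by simp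
  have "E \<subseteq> Pow V" using linkage unfolding linkage_def simple_graph_def by auto
  then show "finite E" using V finite_subset by blast
  show "V \<noteq> {}" using linkage unfolding linkage_def connected_graph_def by simp
qed

text \<open>The integer multiples of a single basis vector already form an infinite set.\<close>

lemma infinite_lattice: "infinite \<Lambda>"
proof
  assume fin: "finite \<Lambda>"
  obtain k :: 'n where True by blast
  let ?f = "\<lambda>m::int. \<Sum>j\<in>UNIV. of_int (if j = k then m else 0) *\<^sub>R lam j"
  have "inj ?f"
  proof (rule injI)
    fix m m' assume "?f m = ?f m'"
    from is_basis_of_int_combination_inj[OF basis this] show "m = m'" by (metis (full_types))
  qed
  moreover have "range ?f \<subseteq> \<Lambda>"
    unfolding marked_lattice_def lattice_generated_def by fast
  ultimately have "finite (UNIV::int set)"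
    using fin by (meson finite_imageD finite_subset)
  then show False by simp
qed

lemma infinite_VL: "infinite VL"
proof
  assume "finite VL"
  then have fin: "finite (associated_placement p ` VL)" by simp
  obtain v where v: "v \<in> V" using V_nonempty by blast
  have "(\<lambda>\<mu>. p v + \<mu>) ` \<Lambda> \<subseteq> associated_placement p ` VL"
    using v by (force simp: associated_placement_cls[OF v, symmetric] cls_in)
  then have "finite ((\<lambda>\<mu>. p v + \<mu>) ` \<Lambda>)" using fin finite_subset by blast
  then have "finite \<Lambda>" by (rule finite_imageD) (simp add: inj_on_def)
  then show False using infinite_lattice by simp
qed

text \<open>No edge collapses to a single class, because classes have positions and the two endpoints of an
  edge of the linkage have different ones.\<close>

lemma simple_graph_associated: "simple_graph VL EL"
  unfolding simple_graph_def
proof (intro ballI conjI)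
  fix e assume e: "e \<in> EL"
  then obtain u v \<mu> where *: "u \<in> V" "v \<in> V" "\<mu> \<in> \<Lambda>" "e = {cls u \<mu>, cls v \<mu>}"
    by (rule EL_cases)
  then show "e \<subseteq> VL" by (simp add: cls_in)
  have "cls u \<mu> \<noteq> cls v \<mu>"
    using admissible_associated_placement e * unfolding admissible_placement_def by metis
  then show "card e = 2" using * by simp
qed

text \<open>An edge through \<open>x\<close> is a translate \<open>e + \<mu>\<close> with an endpoint \<open>v + \<mu>\<close> at the position of \<open>x\<close>, so
  \<open>e\<close> and \<open>v\<close> determine \<open>\<mu>\<close>.\<close>

lemma finite_degree:
  assumes "x \<in> VL"
  shows "finite {e \<in> EL. x \<in> e}"
proof -
  let ?f = "\<lambda>(e, v). (\<lambda>u. cls u (associated_placement p x - p v)) ` e"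
  have "{e \<in> EL. x \<in> e} \<subseteq> ?f ` (E \<times> V)"
  proof
    fix e assume "e \<in> {e \<in> EL. x \<in> e}"
    then have e: "e \<in> EL" "x \<in> e" by auto
    from e(1) obtain u v \<mu> where *: "{u, v} \<in> E" "u \<in> V" "v \<in> V" "\<mu> \<in> \<Lambda>" "e = {cls u \<mu>, cls v \<mu>}"
      by (rule EL_cases)
    obtain w where w: "w \<in> V" "x = cls w \<mu>" using e * by blast
    then have "associated_placement p x - p w = \<mu>" by (simp add: associated_placement_cls *)
    then have "e = ?f ({u, v}, w)" using * by simp
    then show "e \<in> ?f ` (E \<times> V)" using * w by blast
  qed
  then show ?thesis using finite_E finite_V by (simp add: finite_subset)
qed

text \<open>Positions detect translations: faithfulness and freeness of the action are read off from them.\<close>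

lemma associated_placement_paction:
  assumes "x \<in> VL" and "\<gamma> \<in> \<Lambda>"
  shows "associated_placement p (paction GL \<gamma> x) = associated_placement p x + \<gamma>"
  using assms by (auto elim!: VL_cases simp: paction_cls associated_placement_cls lattice_add)

lemma paction_bij:
  assumes \<gamma>: "\<gamma> \<in> \<Lambda>"
  shows "paction GL \<gamma> \<in> Bij VL"
proof -
  have "bij_betw (paction GL \<gamma>) VL VL"
    by (rule bij_betwI[of _ _ _ "paction GL (- \<gamma>)"])
      (auto elim!: VL_cases simp: paction_cls cls_in lattice_closed \<gamma>)
  then show ?thesis by (simp add: Bij_def) (simp add: associated_graph_def)
qed

lemma faithful_action_associated: "faithful_action (pgroup GL) VL (paction GL)"
proof -
  have "group (pgroup GL)"
    using comm_group_lattice[of lam] by (simp add: pgroup_GL marked_lattice_def comm_group_def)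
  moreover have "paction GL \<in> hom (pgroup GL) (BijGroup VL)"
  proof (rule homI)
    fix \<gamma> assume "\<gamma> \<in> carrier (pgroup GL)"
    then show "paction GL \<gamma> \<in> carrier (BijGroup VL)"
      by (simp add: BijGroup_def carrier_GL paction_bij)
  next
    fix \<gamma> \<delta> assume "\<gamma> \<in> carrier (pgroup GL)" "\<delta> \<in> carrier (pgroup GL)"
    then have \<gamma>: "\<gamma> \<in> \<Lambda>" and \<delta>: "\<delta> \<in> \<Lambda>" by (simp_all add: carrier_GL)
    have "paction GL (\<gamma> + \<delta>) = compose VL (paction GL \<gamma>) (paction GL \<delta>)"
    proof (rule extensionalityI[of _ VL])
      show "paction GL (\<gamma> + \<delta>) \<in> extensional VL" by (simp add: associated_graph_def)
      fix x assume "x \<in> VL"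
      then show "paction GL (\<gamma> + \<delta>) x = compose VL (paction GL \<gamma>) (paction GL \<delta>) x"
        by (auto elim!: VL_cases
            simp: compose_eq cls_in paction_cls lattice_add \<gamma> \<delta> add.assoc)
    qed simp
    then show "paction GL (\<gamma> \<otimes>\<^bsub>pgroup GL\<^esub> \<delta>)
        = paction GL \<gamma> \<otimes>\<^bsub>BijGroup VL\<^esub> paction GL \<delta>"
      using \<gamma> \<delta> by (simp add: pgroup_GL vector_group_def BijGroup_def paction_bij)
  qed
  moreover have "inj_on (paction GL) (carrier (pgroup GL))"
  proof (rule inj_onI)
    fix \<gamma> \<delta> assume *: "\<gamma> \<in> carrier (pgroup GL)" "\<delta> \<in> carrier (pgroup GL)"
      "paction GL \<gamma> = paction GL \<delta>"
    obtain v where "v \<in> V" using V_nonempty by blast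
    then have "cls v 0 \<in> VL" by (simp add: cls_in lattice_0)
    then show "\<gamma> = \<delta>"
      using associated_placement_paction * by (metis add_left_cancel carrier_GL)
  qed
  ultimately show ?thesis
    unfolding faithful_action_def faithful_action_axioms_def group_action_def group_hom_def
      group_hom_axioms_def
    by (simp add: group_BijGroup)
qed

lemma paction_vertex_free:
  assumes "\<gamma> \<in> \<Lambda>" and "\<gamma> \<noteq> 0" and "x \<in> VL"
  shows "paction GL \<gamma> x \<noteq> x"
  using associated_placement_paction[of x \<gamma>] assms by (metis add_cancel_right_right)

text \<open>A translation that fixes an edge but no vertex exchanges the endpoints, so its double is zero.\<close>

lemma paction_edge_free:
  assumes \<gamma>: "\<gamma> \<in> \<Lambda>" "\<gamma> \<noteq> 0" and e: "e \<in> EL"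
  shows "paction GL \<gamma> ` e \<noteq> e"
proof -
  from e obtain u v \<mu> where *: "u \<in> V" "v \<in> V" "\<mu> \<in> \<Lambda>" "e = {cls u \<mu>, cls v \<mu>}"
    by (rule EL_cases)
  show "paction GL \<gamma> ` e \<noteq> e"
  proof
    assume "paction GL \<gamma> ` e = e"
    then have "{paction GL \<gamma> (cls u \<mu>), paction GL \<gamma> (cls v \<mu>)} = {cls u \<mu>, cls v \<mu>}"
      using * by simp
    moreover have "paction GL \<gamma> (cls u \<mu>) \<noteq> cls u \<mu>"
      using paction_vertex_free[OF \<gamma> cls_in] * by simp
    ultimately have swap: "paction GL \<gamma> (cls u \<mu>) = cls v \<mu>" "paction GL \<gamma> (cls v \<mu>) = cls u \<mu>"
      by (auto simp: doubleton_eq_iff)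
    have "p v + \<mu> = p u + \<mu> + \<gamma>" "p u + \<mu> = p v + \<mu> + \<gamma>"
      using associated_placement_paction[OF cls_in \<gamma>(1)] swap *
      by (metis associated_placement_cls)+
    then have "\<gamma> + \<gamma> = 0" by (simp add: algebra_simps)
    then have "2 *\<^sub>R \<gamma> = 0" by (simp add: scaleR_2)
    then show False using \<gamma> by simp
  qed
qed

lemma translate_lattice: "\<mu> \<in> \<Lambda> \<Longrightarrow> (\<lambda>\<gamma>. \<gamma> + \<mu>) ` \<Lambda> = \<Lambda>"
proof
  assume \<mu>: "\<mu> \<in> \<Lambda>"
  then show "(\<lambda>\<gamma>. \<gamma> + \<mu>) ` \<Lambda> \<subseteq> \<Lambda>" by (auto simp: lattice_add)
  show "\<Lambda> \<subseteq> (\<lambda>\<gamma>. \<gamma> + \<mu>) ` \<Lambda>"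
  proof
    fix x assume "x \<in> \<Lambda>"
    then have "x + - \<mu> \<in> \<Lambda>" using \<mu> lattice_closed by blast
    then show "x \<in> (\<lambda>\<gamma>. \<gamma> + \<mu>) ` \<Lambda>" by (rule rev_image_eqI) simp
  qed
qed

text \<open>The orbit of the class of \<open>v + \<mu>\<close> does not depend on \<open>\<mu>\<close>, so the finitely many vertices of the
  linkage represent all orbits; the same holds for edges.\<close>

lemma finite_vertex_orbits: "finite (orbits (pgroup GL) VL (paction GL))"
proof -
  have "orbit (pgroup GL) (paction GL) (cls v \<mu>) = cls v ` \<Lambda>" if "v \<in> V" "\<mu> \<in> \<Lambda>" for v \<mu>
  proof -
    have "orbit (pgroup GL) (paction GL) (cls v \<mu>) = (\<lambda>\<gamma>. cls v (\<gamma> + \<mu>)) ` \<Lambda>"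
      unfolding orbit_def carrier_GL using that by (force simp: paction_cls)
    also have "\<dots> = cls v ` (\<lambda>\<gamma>. \<gamma> + \<mu>) ` \<Lambda>" by (simp add: image_image)
    finally show ?thesis using that by (simp only: translate_lattice)
  qed
  then have "orbits (pgroup GL) VL (paction GL) \<subseteq> (\<lambda>v. cls v ` \<Lambda>) ` V"
    unfolding orbits_def by (auto elim!: VL_cases)
  then show ?thesis using finite_V finite_subset by blast
qed

lemma finite_edge_orbits: "finite (orbits (pgroup GL) EL (\<lambda>\<gamma> e. paction GL \<gamma> ` e))"
proof -
  let ?t = "\<lambda>e \<nu>. (\<lambda>w. cls w \<nu>) ` e"
  have orbit: "orbit (pgroup GL) (\<lambda>\<gamma> e. paction GL \<gamma> ` e) {cls u \<mu>, cls v \<mu>} = ?t {u, v} ` \<Lambda>"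
    if "u \<in> V" "v \<in> V" "\<mu> \<in> \<Lambda>" for u v \<mu>
  proof -
    have "orbit (pgroup GL) (\<lambda>\<gamma> e. paction GL \<gamma> ` e) {cls u \<mu>, cls v \<mu>} = (\<lambda>\<gamma>. ?t {u, v} (\<gamma> + \<mu>)) ` \<Lambda>"
      unfolding orbit_def carrier_GL using that by (force simp: paction_cls)
    also have "\<dots> = ?t {u, v} ` (\<lambda>\<gamma>. \<gamma> + \<mu>) ` \<Lambda>" by (simp add: image_image)
    finally show ?thesis using that by (simp only: translate_lattice)
  qed
  have "orbits (pgroup GL) EL (\<lambda>\<gamma> e. paction GL \<gamma> ` e) \<subseteq> (\<lambda>e. ?t e ` \<Lambda>) ` E"
  proof
    fix X assume "X \<in> orbits (pgroup GL) EL (\<lambda>\<gamma> e. paction GL \<gamma> ` e)"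
    then obtain e where e: "e \<in> EL" and X: "X = orbit (pgroup GL) (\<lambda>\<gamma> e. paction GL \<gamma> ` e) e"
      unfolding orbits_def by blast
    from e obtain u v \<mu> where *: "{u, v} \<in> E" "u \<in> V" "v \<in> V" "\<mu> \<in> \<Lambda>" "e = {cls u \<mu>, cls v \<mu>}"
      by (rule EL_cases)
    then have "X = ?t {u, v} ` \<Lambda>" using X orbit by simp
    then show "X \<in> (\<lambda>e. ?t e ` \<Lambda>) ` E" by (rule image_eqI) (rule *(1))
  qed
  then show ?thesis using finite_E finite_subset by blast
qed

lemma d_periodic_graph_associated: "d_periodic_graph CARD('n) GL"
  unfolding d_periodic_graph_def pverts_GL pedges_GL
proof (intro conjI ballI impI)
  show "comm_group (pgroup GL)"
    by (simp add: pgroup_GL marked_lattice_def comm_group_lattice)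
  show "pgroup GL \<cong> free_Abelian_group {..<CARD('n)}"
    by (simp add: pgroup_GL marked_lattice_def lattice_iso_free_Abelian_group basis)
next
  fix \<gamma> e assume "\<gamma> \<in> carrier (pgroup GL)" "e \<in> EL"
  then show "paction GL \<gamma> ` e \<in> EL"
    by (auto elim!: EL_cases simp: carrier_GL paction_cls EL_I lattice_add)
next
  fix \<gamma> x assume "\<gamma> \<in> carrier (pgroup GL)" "\<gamma> \<noteq> \<one>\<^bsub>pgroup GL\<^esub>" "x \<in> VL"
  then show "paction GL \<gamma> x \<noteq> x"
    using paction_vertex_free by (simp add: carrier_GL pgroup_GL vector_group_def)
next
  fix \<gamma> e assume "\<gamma> \<in> carrier (pgroup GL)" "\<gamma> \<noteq> \<one>\<^bsub>pgroup GL\<^esub>" "e \<in> EL"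
  then show "paction GL \<gamma> ` e \<noteq> e"
    using paction_edge_free by (simp add: carrier_GL pgroup_GL vector_group_def)
qed (simp_all add: infinite_VL simple_graph_associated finite_degree faithful_action_associated
    finite_vertex_orbits finite_edge_orbits)

section \<open>Deformations of the linkage and of the periodic framework\<close>

lemma periodic_framework_lifted:
  assumes q: "is_basis (marked_vector q vi vj)" and adm: "admissible_placement E q"
  shows "periodic_framework GL (lifted_placement q) (basis_map lam (marked_vector q vi vj))"
  unfolding periodic_framework_def carrier_GL pverts_GL pedges_GL
proof (intro conjI ballI)
  let ?\<pi> = "basis_map lam (marked_vector q vi vj)"
  have lin: "linear ?\<pi>" by (rule linear_basis_map[OF basis])
  show "d_periodic_graph CARD('n) GL" by (rule d_periodic_graph_associated)
  show "?\<pi> \<in> hom (pgroup GL) (vector_group UNIV)"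
    by (auto simp: hom_def pgroup_GL vector_group_def linear_add[OF lin])
  show "inj_on ?\<pi> \<Lambda>"
    unfolding marked_lattice_def by (rule inj_basis_map_lattice[OF basis q])
  show "full_lattice (?\<pi> ` \<Lambda>)"
    unfolding marked_lattice_def basis_map_image_lattice[OF basis] full_lattice_def using q by blast
next
  fix \<gamma> x assume "\<gamma> \<in> \<Lambda>" "x \<in> VL"
  then show "lifted_placement q (paction GL \<gamma> x)
      = lifted_placement q x + basis_map lam (marked_vector q vi vj) \<gamma>"
    by (auto elim!: VL_cases simp: paction_cls lifted_placement_cls lattice_add
        linear_add[OF linear_basis_map[OF basis]])
next
  show "admissible_placement EL (lifted_placement q)"
    unfolding admissible_placement_def
  proof (intro allI impI)
    fix x y assume "{x, y} \<in> EL"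
    then obtain u v \<mu> where *: "{u, v} \<in> E" "\<mu> \<in> \<Lambda>" "x = cls u \<mu>" "y = cls v \<mu>"
      by (rule EL_doubleton_cases)
    then have "q u - q v \<noteq> 0"
      using adm unfolding admissible_placement_def by auto
    then show "lifted_placement q x \<noteq> lifted_placement q y"
      using lifted_placement_edge[OF *(1,2), of q] * by auto
  qed
qed

lemma deformation_path_lifted:
  assumes q: "linkage_deformation V E p \<epsilon> q"
    and bas: "\<And>\<tau>. \<tau> \<in> {-\<epsilon><..<\<epsilon>} \<Longrightarrow> is_basis (marked_vector (q \<tau>) vi vj)"
  shows "deformation_path GL (associated_placement p) associated_translation \<epsilon>
    (\<lambda>\<tau>. lifted_placement (q \<tau>)) (\<lambda>\<tau>. basis_map lam (marked_vector (q \<tau>) vi vj))"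
proof -
  let ?I = "{-\<epsilon><..<\<epsilon>}"
  have q0: "\<And>v. v \<in> V \<Longrightarrow> q 0 v = p v" and \<epsilon>: "\<epsilon> > 0"
    and smooth: "\<And>v. v \<in> V \<Longrightarrow> smooth_curve_on ?I (\<lambda>\<tau>. q \<tau> v)"
    and adm: "\<And>\<tau>. \<tau> \<in> ?I \<Longrightarrow> admissible_placement E (q \<tau>)"
    and len: "\<And>\<tau> u v. \<tau> \<in> ?I \<Longrightarrow> {u, v} \<in> E \<Longrightarrow> dist (q \<tau> u) (q \<tau> v) = dist (p u) (p v)"
    using q unfolding linkage_deformation_def by auto
  have "marked_vector (q 0) vi vj = lam"
    using q0 vi_in vj_in by (simp add: marked_vector_def fun_eq_iff range_subsetD)
  then have \<pi>0: "basis_map lam (marked_vector (q 0) vi vj) x = x" for x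
    by (simp add: basis_map_self[OF basis])
  have smooth_\<pi>: "smooth_curve_on ?I (\<lambda>\<tau>. basis_map lam (marked_vector (q \<tau>) vi vj) x)" for x
    unfolding basis_map_def marked_vector_def[of "q _"] using vi_in vj_in
    by (intro smooth_curve_on_sum smooth_curve_on_scaleR smooth_curve_on_diff smooth) auto
  show ?thesis
    unfolding deformation_path_def carrier_GL pverts_GL pedges_GL
  proof (intro conjI ballI allI impI)
    fix x assume "x \<in> VL"
    then obtain v \<mu> where *: "v \<in> V" "\<mu> \<in> \<Lambda>" "x = cls v \<mu>" by (rule VL_cases)
    show "lifted_placement (q 0) x = associated_placement p x"
      by (simp add: * lifted_placement_cls associated_placement_cls q0 \<pi>0)
    show "smooth_curve_on ?I (\<lambda>\<tau>. lifted_placement (q \<tau>) x)"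
      by (simp add: * lifted_placement_cls smooth_curve_on_add smooth smooth_\<pi>)
  next
    fix \<tau> assume "\<tau> \<in> ?I"
    then show "periodic_framework GL (lifted_placement (q \<tau>)) (basis_map lam (marked_vector (q \<tau>) vi vj))"
      by (intro periodic_framework_lifted bas adm)
  next
    fix \<tau> x y assume \<tau>: "\<tau> \<in> ?I" and xy: "{x, y} \<in> EL"
    from xy obtain u v \<mu> where *: "{u, v} \<in> E" "\<mu> \<in> \<Lambda>" "x = cls u \<mu>" "y = cls v \<mu>"
      by (rule EL_doubleton_cases)
    then show "dist (lifted_placement (q \<tau>) x) (lifted_placement (q \<tau>) y)
        = dist (associated_placement p x) (associated_placement p y)"
      using len[OF \<tau> *(1)]
      by (simp add: dist_norm lifted_placement_edge associated_placement_eq_lifted)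
  qed (simp_all add: \<epsilon> \<pi>0 associated_translation_def smooth_\<pi>)
qed

text \<open>The vertices \<open>v\<^sub>j\<close> and \<open>v\<^sub>i + \<lambda>\<^sub>k\<close> of the periodic graph coincide, so periodicity of the placement
  forces the marked vectors to be the periods.\<close>

lemma marked_vector_restricted:
  assumes "periodic_framework GL P \<pi>"
  shows "marked_vector (\<lambda>v. P (cls v 0)) vi vj k = \<pi> (lam k)"
proof -
  have vi: "cls (vi k) 0 \<in> VL" using vi_in by (simp add: cls_in lattice_0 range_subsetD)
  have "cls (vj k) 0 = paction GL (lam k) (cls (vi k) 0)"
    using cls_marked[OF lattice_0, of k] vi_in
    by (simp add: paction_cls lattice_0 lattice_generator range_subsetD)
  also have "P \<dots> = P (cls (vi k) 0) + \<pi> (lam k)"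
    using assms vi lattice_generator unfolding periodic_framework_def carrier_GL pverts_GL by blast
  finally show ?thesis by (simp add: marked_vector_def[of "\<lambda>v. P (cls v 0)"])
qed

text \<open>The images of the \<open>\<lambda>\<^sub>k\<close> generate the image lattice, which contains a basis of the space.\<close>

lemma is_basis_translations:
  assumes "periodic_framework GL P \<pi>"
  shows "is_basis (\<lambda>k. \<pi> (lam k))"
proof (rule is_basis_if_span)
  have hom: "\<pi> \<in> hom (vector_group (lattice_generated lam)) (vector_group UNIV)"
    and "full_lattice (\<pi> ` lattice_generated lam)"
    using assms carrier_GL unfolding periodic_framework_def pgroup_GL marked_lattice_def by simp_all
  then obtain b where b: "is_basis b" "\<pi> ` lattice_generated lam = lattice_generated b"
    unfolding full_lattice_def by blast
  have "\<pi> ` lattice_generated lam \<subseteq> lattice_generated (\<lambda>k. \<pi> (lam k))"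
  proof
    fix y assume "y \<in> \<pi> ` lattice_generated lam"
    then obtain n where "y = \<pi> (\<Sum>k\<in>UNIV. of_int (n k) *\<^sub>R lam k)"
      unfolding lattice_generated_def by blast
    then have "y = (\<Sum>k\<in>UNIV. of_int (n k) *\<^sub>R \<pi> (lam k))"
      using hom_lattice_combination[OF hom lattice_generated_generator, of UNIV n "\<lambda>k. k"] by simp
    then show "y \<in> lattice_generated (\<lambda>k. \<pi> (lam k))"
      unfolding lattice_generated_iff by blast
  qed
  then have "range b \<subseteq> span (range (\<lambda>k. \<pi> (lam k)))"
    using b lattice_generated_generator lattice_generated_subset_span by blast
  then have "span (range b) \<subseteq> span (range (\<lambda>k. \<pi> (lam k)))"
    by (simp add: span_minimal)
  then show "span (range (\<lambda>k. \<pi> (lam k))) = UNIV"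
    using b unfolding is_basis_def by blast
qed

text \<open>The linkage sits in the framework as the symbols \<open>v + 0\<close>, and its edges are edges there.\<close>

lemma linkage_deformation_restricted:
  assumes P: "deformation_path GL (associated_placement p) associated_translation \<epsilon> P' \<pi>'"
  shows "linkage_deformation V E p \<epsilon> (\<lambda>\<tau> v. P' \<tau> (cls v 0))"
  unfolding linkage_deformation_def
proof (intro conjI ballI allI impI)
  show "\<epsilon> > 0" using P unfolding deformation_path_def by simp
  fix v assume "v \<in> V"
  then show "P' 0 (cls v 0) = p v" "smooth_curve_on {-\<epsilon><..<\<epsilon>} (\<lambda>\<tau>. P' \<tau> (cls v 0))"
    using P unfolding deformation_path_def pverts_GL
    by (simp_all add: cls_in lattice_0 associated_placement_cls)
next
  fix \<tau> u v assume \<tau>: "\<tau> \<in> {-\<epsilon><..<\<epsilon>}" and uv: "{u, v} \<in> E"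
  show "dist (P' \<tau> (cls u 0)) (P' \<tau> (cls v 0)) = dist (p u) (p v)"
    using P \<tau> EL_I[OF uv lattice_0] edge_in_V[OF uv] unfolding deformation_path_def pedges_GL
    by (simp add: associated_placement_cls lattice_0)
next
  fix \<tau> assume \<tau>: "\<tau> \<in> {-\<epsilon><..<\<epsilon>}"
  then have "admissible_placement EL (P' \<tau>)"
    using P unfolding deformation_path_def periodic_framework_def pedges_GL by simp
  then show "admissible_placement E (\<lambda>v. P' \<tau> (cls v 0))"
    unfolding admissible_placement_def using EL_I[OF _ lattice_0] by blast
qed

lemma auxetic_path_iff:
  assumes g: "independent_generators (pgroup GL) g"
  shows "has_nontrivial_auxetic_path GL (associated_placement p) associated_translation g \<longleftrightarrow>
    (\<exists>\<epsilon> q. linkage_deformation V E p \<epsilon> q \<and>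
       (\<forall>\<tau>\<in>{-\<epsilon><..<\<epsilon>}. is_basis (marked_vector (q \<tau>) vi vj)) \<and>
       nonconstant_psd_curve \<epsilon> (\<lambda>\<tau>. marked_gram (q \<tau>) vi vj))"
proof -
  \<comment> \<open>Both directions end with this comparison: in each, the periods along the path are the marked
    vectors, while the Gram matrices of the framework refer to the generators \<open>g\<close>.\<close>
  have gram_iff: "nonconstant_psd_curve \<epsilon> (\<lambda>\<tau>. framework_gram g (\<pi>' \<tau>)) \<longleftrightarrow>
      nonconstant_psd_curve \<epsilon> (\<lambda>\<tau>. marked_gram (q \<tau>) vi vj)"
    if P: "deformation_path GL (associated_placement p) associated_translation \<epsilon> P' \<pi>'"
      and q: "\<And>\<tau> k. \<tau> \<in> {-\<epsilon><..<\<epsilon>} \<Longrightarrow> marked_vector (q \<tau>) vi vj k = \<pi>' \<tau> (lam k)"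
    for \<epsilon> P' \<pi>' q
    unfolding marked_gram_eq
  proof (rule nonconstant_psd_curve_generators)
    show "independent_generators (vector_group (lattice_generated lam)) g"
      using g by (simp add: pgroup_GL marked_lattice_def)
    show "\<pi>' \<tau> \<in> hom (vector_group (lattice_generated lam)) (vector_group UNIV)"
      if "\<tau> \<in> {-\<epsilon><..<\<epsilon>}" for \<tau>
      using P that unfolding deformation_path_def periodic_framework_def
      by (simp add: pgroup_GL marked_lattice_def)
    show "smooth_curve_on {-\<epsilon><..<\<epsilon>} (\<lambda>\<tau>. \<pi>' \<tau> x)" if "x \<in> lattice_generated lam" for x
      using P that unfolding deformation_path_def carrier_GL by (simp add: marked_lattice_def)
  qed (rule q)
  show ?thesis
  proof
    assume "has_nontrivial_auxetic_path GL (associated_placement p) associated_translation g"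
    then obtain \<epsilon> P' \<pi>' where
      P: "deformation_path GL (associated_placement p) associated_translation \<epsilon> P' \<pi>'"
      and psd: "nonconstant_psd_curve \<epsilon> (\<lambda>\<tau>. framework_gram g (\<pi>' \<tau>))"
      unfolding has_nontrivial_auxetic_path_def by blast
    let ?q = "\<lambda>\<tau> v. P' \<tau> (cls v 0)"
    have fw: "periodic_framework GL (P' \<tau>) (\<pi>' \<tau>)" if "\<tau> \<in> {-\<epsilon><..<\<epsilon>}" for \<tau>
      using P that unfolding deformation_path_def by blast
    have mv: "marked_vector (?q \<tau>) vi vj = (\<lambda>k. \<pi>' \<tau> (lam k))" if "\<tau> \<in> {-\<epsilon><..<\<epsilon>}" for \<tau>
      using marked_vector_restricted[OF fw[OF that]] by blast
    have "nonconstant_psd_curve \<epsilon> (\<lambda>\<tau>. marked_gram (?q \<tau>) vi vj)"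
      using gram_iff[OF P, of ?q] psd mv by simp
    then show "\<exists>\<epsilon> q. linkage_deformation V E p \<epsilon> q \<and>
       (\<forall>\<tau>\<in>{-\<epsilon><..<\<epsilon>}. is_basis (marked_vector (q \<tau>) vi vj)) \<and>
       nonconstant_psd_curve \<epsilon> (\<lambda>\<tau>. marked_gram (q \<tau>) vi vj)"
      using linkage_deformation_restricted[OF P] mv is_basis_translations[OF fw]
      by (intro exI[of _ \<epsilon>] exI[of _ ?q]) simp
  next
    assume "\<exists>\<epsilon> q. linkage_deformation V E p \<epsilon> q \<and>
       (\<forall>\<tau>\<in>{-\<epsilon><..<\<epsilon>}. is_basis (marked_vector (q \<tau>) vi vj)) \<and>
       nonconstant_psd_curve \<epsilon> (\<lambda>\<tau>. marked_gram (q \<tau>) vi vj)"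
    then obtain \<epsilon> q where q: "linkage_deformation V E p \<epsilon> q"
      "\<And>\<tau>. \<tau> \<in> {-\<epsilon><..<\<epsilon>} \<Longrightarrow> is_basis (marked_vector (q \<tau>) vi vj)"
      and psd: "nonconstant_psd_curve \<epsilon> (\<lambda>\<tau>. marked_gram (q \<tau>) vi vj)"
      by blast
    from deformation_path_lifted[OF q]
    show "has_nontrivial_auxetic_path GL (associated_placement p) associated_translation g"
      unfolding has_nontrivial_auxetic_path_def
      using gram_iff[OF deformation_path_lifted[OF q], of q] psd
      by (auto simp: basis_map_basis[OF basis])
  qed
qed

end

theorem theorem2:
  fixes V :: "'v set" and E :: "'v set set" and p :: "'v \<Rightarrow> real^'n"
    and vi vj :: "'n \<Rightarrow> 'v" and g :: "'n \<Rightarrow> real^'n"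
  assumes "CARD('n) \<ge> 2"
    and "linkage V E p"
    and "infinitesimally_independent E p"
    and "range vi \<subseteq> V" and "range vj \<subseteq> V"
    and "is_basis (marked_vector p vi vj)"
    and "independent_generators (pgroup (associated_graph V E p vi vj)) g"
  shows "has_nontrivial_auxetic_path (associated_graph V E p vi vj)
           (associated_placement p) associated_translation g \<longleftrightarrow>
         (\<exists>\<epsilon> q. linkage_deformation V E p \<epsilon> q \<and>
            (\<forall>\<tau>\<in>{-\<epsilon><..<\<epsilon>}. is_basis (marked_vector (q \<tau>) vi vj)) \<and>
            nonconstant_psd_curve \<epsilon> (\<lambda>\<tau>. marked_gram (q \<tau>) vi vj))"
proof -
  interpret marked_linkage V E p vi vj
    using assms by unfold_locales
  show ?thesis by (rule auxetic_path_iff) (rule assms)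
qed

end
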